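(* Let $G$ be a group with a $BN$-pair $(B,N)$ and a finite Weyl group $W=N/H$, where $H=B\cap N$, and let $n_0\in N$ be such that $n_0H=w_0$, the longest element of $W$. Let $U\leq B$ be a subgroup satisfying $B=UH$. Then $G=HUU^{n_{0}}U$.
   Context: $G$ need not be finite. $G$ is a group with a $BN$-pair if there exist subgroups $B$ and $N$ of $G$ such that: (i) $G=\langle B,N\rangle$; (ii) $H:=B\cap N\trianglelefteq N$; (iii) $W:=N/H$ (the Weyl group of the $BN$-pair) is generated by a set of elements $s_{i}$, $i\in I$, with $s_{i}^{2}=1$ for all $i\in I$; (iv) for any $n_{i}\in N$ such that $s_{i}=n_{i}H$, $n_{i}Bn_{i}\neq B$; (v) $n_{i}Bn\subseteq Bn_{i}nB\cup BnB$ for all $n\in N$ and all $n_{i}\in N$ such that $s_{i}=n_{i}H$. The length $l(w)$ of $w\in W$ is the minimal length of an expression for $w$ as a product of the $s_i$ (with $l(1_W)=0$). If $W$ is finite there is a unique element $w_{0}\in W$ such that $l(w_{0})>l(w)$ for all $w\in W$, $w\neq w_{0}$. Products of subsets are setwise, and $U^{n_0}=n_0^{-1}Un_0$. *)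

theory Defs
  imports "HOL-Algebra.Coset" "HOL-Algebra.Generated_Groups"
begin

definition weyl_group :: "('a, 'b) monoid_scheme \<Rightarrow> 'a set \<Rightarrow> 'a set \<Rightarrow> 'a set monoid" where
  "weyl_group G B N = (G\<lparr>carrier := N\<rparr>) Mod (B \<inter> N)"

text \<open>The library's quotient consists of right cosets. Since \<open>B \<inter> N\<close> is assumed normal
  in \<open>N\<close>, these are the left cosets \<open>n <# (B \<inter> N)\<close> with \<open>n \<in> N\<close>.\<close>

locale bn_pair = group G for G (structure) +
  fixes B N :: "'a set" and I :: "'i set" and s :: "'i \<Rightarrow> 'a set"
  assumes subgroup_B: "subgroup B G"
    and subgroup_N: "subgroup N G"
    and generated: "generate G (B \<union> N) = carrier G"
    and normal_H: "(B \<inter> N) \<lhd> (G\<lparr>carrier := N\<rparr>)"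
    and s_closed: "\<And>i. i \<in> I \<Longrightarrow> s i \<in> carrier (weyl_group G B N)"
    and s_generate: "generate (weyl_group G B N) (s ` I) = carrier (weyl_group G B N)"
    and s_square: "\<And>i. i \<in> I \<Longrightarrow>
      s i [^]\<^bsub>weyl_group G B N\<^esub> (2::nat) = \<one>\<^bsub>weyl_group G B N\<^esub>"
    and not_stable: "\<And>i m. \<lbrakk>i \<in> I; m \<in> N; s i = m <# (B \<inter> N)\<rbrakk> \<Longrightarrow> m <# B #> m \<noteq> B"
    and exchange: "\<And>i m n. \<lbrakk>i \<in> I; m \<in> N; s i = m <# (B \<inter> N); n \<in> N\<rbrakk> \<Longrightarrow>
      m <# B #> n \<subseteq> (B #> (m \<otimes> n) <#> B) \<union> (B #> n <#> B)"

definition word_length :: "('w, 'b) monoid_scheme \<Rightarrow> 'i set \<Rightarrow> ('i \<Rightarrow> 'w) \<Rightarrow> 'w \<Rightarrow> nat" where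
  "word_length W I s w =
    (LEAST k. \<exists>is. length is = k \<and> set is \<subseteq> I \<and> w = foldr (\<otimes>\<^bsub>W\<^esub>) (map s is) \<one>\<^bsub>W\<^esub>)"

definition is_longest :: "('w, 'b) monoid_scheme \<Rightarrow> 'i set \<Rightarrow> ('i \<Rightarrow> 'w) \<Rightarrow> 'w \<Rightarrow> bool" where
  "is_longest W I s w0 \<longleftrightarrow> w0 \<in> carrier W \<and>
    (\<forall>w\<in>carrier W. w \<noteq> w0 \<longrightarrow> word_length W I s w < word_length W I s w0)"

end

theory Submission
  imports Defs
begin

text \<open>Write \<open>C n = B n B\<close>. For every simple \<open>m\<close>, maximality of \<open>n0\<close> forces
  \<open>C n0 C m \<supseteq> C n0\<close>. Since \<open>C\<close> is multiplicative along reduced words, \<open>C n0 C z \<supseteq> C n0\<close> for every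
  \<open>z \<in> N\<close>, which says exactly that \<open>z \<in> B (inv n0) B n0 B\<close>. By the Bruhat decomposition
  \<open>G = B (inv n0) B n0 B\<close>, and \<open>B = U H\<close> with \<open>n0\<close> normalising \<open>H\<close> lets all the factors \<open>H\<close> be
  collected on the left.\<close>

context bn_pair
begin

section \<open>Representatives, double cosets and words in the Weyl group\<close>

abbreviation H :: "'a set" where "H \<equiv> B \<inter> N"

abbreviation W :: "'a set monoid" where "W \<equiv> weyl_group G B N"

text \<open>Elements of \<open>W\<close> are cosets, so this union collects every \<open>n_i\<close>
  in \<open>N\<close> that represents a generator; the axioms \<open>not_stable\<close> and
  \<open>exchange\<close> speak of all of them.\<close>

definition simple_reps :: "'a set" where
  "simple_reps = \<Union> (s ` I)"

text \<open>The double coset \<open>B n B\<close>, called \<open>C n\<close> in the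
  overview.\<close>

definition cell :: "'a \<Rightarrow> 'a set" where
  "cell n = B #> n <#> B"

text \<open>Lengths are measured on representatives: \<open>word k n\<close> means that the coset \<open>n H\<close> is a
  product of \<open>k\<close> of the generators \<open>s i\<close>.\<close>

inductive word :: "nat \<Rightarrow> 'a \<Rightarrow> bool" where
  word_H: "h \<in> H \<Longrightarrow> word 0 h"
| word_step: "m \<in> simple_reps \<Longrightarrow> word k n \<Longrightarrow> word (Suc k) (m \<otimes> n)"

text \<open>For \<open>n\<close> in \<open>N\<close> this is the length of the coset
  \<open>n H\<close> (\<open>word_length_eq\<close>); that the minimum is attained rests on
  \<open>ex_word\<close>.\<close>

definition len :: "'a \<Rightarrow> nat" where
  "len n = (LEAST k. word k n)"

section \<open>Subgroup closure and the quotient \<open>W\<close> in terms of left cosets\<close>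

lemma B_carrier [simp]: "b \<in> B \<Longrightarrow> b \<in> carrier G"
  using subgroup.mem_carrier[OF subgroup_B] .

lemma N_carrier [simp]: "n \<in> N \<Longrightarrow> n \<in> carrier G"
  using subgroup.mem_carrier[OF subgroup_N] .

lemma B_closed [simp]:
  "a \<in> B \<Longrightarrow> b \<in> B \<Longrightarrow> a \<otimes> b \<in> B" "b \<in> B \<Longrightarrow> inv b \<in> B" "\<one> \<in> B"
  using subgroup_B by (auto simp: subgroup.m_closed subgroup.m_inv_closed subgroup.one_closed)

lemma N_closed [simp]:
  "a \<in> N \<Longrightarrow> b \<in> N \<Longrightarrow> a \<otimes> b \<in> N" "b \<in> N \<Longrightarrow> inv b \<in> N" "\<one> \<in> N"
  using subgroup_N by (auto simp: subgroup.m_closed subgroup.m_inv_closed subgroup.one_closed)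

lemma cancel_inv [simp]:
  "x \<in> carrier G \<Longrightarrow> y \<in> carrier G \<Longrightarrow> inv x \<otimes> (x \<otimes> y) = y"
  "x \<in> carrier G \<Longrightarrow> y \<in> carrier G \<Longrightarrow> x \<otimes> (inv x \<otimes> y) = y"
  by (simp_all add: m_assoc[symmetric])

lemma H_conj: "n \<in> N \<Longrightarrow> h \<in> H \<Longrightarrow> n \<otimes> h \<otimes> inv n \<in> H"
  using normal.inv_op_closed2[OF normal_H, of n h] m_inv_consistent[OF subgroup_N]
  by simp

lemma H_conj': "n \<in> N \<Longrightarrow> h \<in> H \<Longrightarrow> inv n \<otimes> h \<otimes> n \<in> H"
  using H_conj[of "inv n" h] by simp

lemma group_W: "group W"
  unfolding weyl_group_def by (rule normal.factorgroup_is_group[OF normal_H])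

lemma one_W: "\<one>\<^bsub>W\<^esub> = H"
  by (simp add: weyl_group_def FactGroup_def)

lemma mult_W: "X \<otimes>\<^bsub>W\<^esub> Y = X <#> Y"
  by (simp add: weyl_group_def FactGroup_def set_mult_def)

lemma mem_mult_W: "x \<in> X \<otimes>\<^bsub>W\<^esub> Y \<longleftrightarrow> (\<exists>a\<in>X. \<exists>b\<in>Y. x = a \<otimes> b)"
  by (auto simp: mult_W set_mult_def)

lemma l_coset_mem_iff: "n \<in> N \<Longrightarrow> x \<in> n <# H \<longleftrightarrow> (\<exists>h\<in>H. x = n \<otimes> h)"
  by (auto simp: l_coset_def)

lemma l_coset_W: "n \<in> N \<Longrightarrow> n <# H \<in> carrier W"
proof -
  assume n: "n \<in> N"
  have "H #> n = n <# H"
    using normal.coset_eq[OF normal_H] n by (simp add: r_coset_def l_coset_def)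
  then show ?thesis using n
    by (auto simp: weyl_group_def FactGroup_def RCOSETS_def r_coset_def)
qed

lemma carrier_W:
  assumes "X \<in> carrier W"
  shows "\<exists>n\<in>N. X = n <# H"
proof -
  from assms obtain n where n: "n \<in> N" "X = H #> n"
    by (auto simp: weyl_group_def FactGroup_def RCOSETS_def r_coset_def)
  then have "H #> n = n <# H"
    using normal.coset_eq[OF normal_H] by (simp add: r_coset_def l_coset_def)
  with n show ?thesis by blast
qed

lemma l_coset_cong:
  assumes "n \<in> N" "h \<in> H"
  shows "(n \<otimes> h) <# H = n <# H"
proof -
  have "\<exists>k\<in>H. n \<otimes> x = n \<otimes> h \<otimes> k" if "x \<in> H" for x
    using that assms by (intro bexI[of _ "inv h \<otimes> x"]) (auto simp: m_assoc)
  moreover have "\<exists>k\<in>H. n \<otimes> h \<otimes> x = n \<otimes> k" if "x \<in> H" for x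
    using that assms by (intro bexI[of _ "h \<otimes> x"]) (auto simp: m_assoc)
  ultimately show ?thesis unfolding l_coset_def by blast
qed

text \<open>Bridge from the quotient to representatives: multiplying \<open>a\<close> by an element
  of \<open>H\<close> does not change the coset \<open>a H\<close>, so every element of a coset
  represents it.\<close>

lemma W_mem:
  assumes "X \<in> carrier W"
  shows "n \<in> X \<longleftrightarrow> n \<in> N \<and> X = n <# H"
proof -
  obtain a where a: "a \<in> N" "X = a <# H" using carrier_W[OF assms] by blast
  show ?thesis
  proof
    assume "n \<in> X"
    then obtain h where "h \<in> H" "n = a \<otimes> h" using a l_coset_mem_iff by auto
    then show "n \<in> N \<and> X = n <# H" using a l_coset_cong by auto
  next
    assume n: "n \<in> N \<and> X = n <# H"
    then have "n \<otimes> \<one> \<in> n <# H" by (auto simp: l_coset_def)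
    with n show "n \<in> X" by simp
  qed
qed

section \<open>Representatives of the generators\<close>

lemma simple_reps_iff: "m \<in> simple_reps \<longleftrightarrow> (\<exists>i\<in>I. m \<in> N \<and> s i = m <# H)"
  unfolding simple_reps_def using W_mem[OF s_closed] by auto

lemma simple_N [simp]: "m \<in> simple_reps \<Longrightarrow> m \<in> N"
  using simple_reps_iff by blast

lemma simple_square:
  assumes "m \<in> simple_reps"
  shows "m \<otimes> m \<in> H"
proof -
  interpret W: group W by (rule group_W)
  obtain i where i: "i \<in> I" "m \<in> s i" using assms by (auto simp: simple_reps_def)
  have "s i \<otimes>\<^bsub>W\<^esub> s i = \<one>\<^bsub>W\<^esub>"
    using s_square[OF i(1)] s_closed[OF i(1)] by (simp add: numeral_2_eq_2)
  then have "s i <#> s i = H" by (simp only: one_W mult_W)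
  then show ?thesis using i by (auto simp: set_mult_def)
qed

lemma simple_mult_H:
  assumes "m \<in> simple_reps" "h \<in> H"
  shows "m \<otimes> h \<in> simple_reps"
proof -
  obtain i where "i \<in> I" "m \<in> N" "s i = m <# H" using assms simple_reps_iff by blast
  then have "i \<in> I" "m \<otimes> h \<in> N" "s i = (m \<otimes> h) <# H"
    using l_coset_cong assms(2) by simp_all
  then show ?thesis using simple_reps_iff by blast
qed

lemma H_mult_simple:
  assumes "m \<in> simple_reps" "h \<in> H"
  shows "h \<otimes> m \<in> simple_reps"
proof -
  have "h \<otimes> m = m \<otimes> (inv m \<otimes> h \<otimes> m)" using assms by (simp add: m_assoc)
  then show ?thesis using simple_mult_H[OF assms(1) H_conj'] assms by auto
qed

text \<open>Since \<open>m m\<close> lies in \<open>H\<close>, the inverse of \<open>m\<close>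
  differs from \<open>m\<close> by a factor in \<open>H\<close> and represents the same
  generator.\<close>

lemma simple_inv [simp]:
  assumes "m \<in> simple_reps"
  shows "inv m \<in> simple_reps"
proof -
  have "inv m = m \<otimes> inv (m \<otimes> m)"
    using assms by (simp add: inv_mult_group m_assoc)
  moreover have "inv (m \<otimes> m) \<in> H" using simple_square[OF assms] by simp
  ultimately show ?thesis using simple_mult_H[OF assms] by metis
qed

lemma simple_exchange:
  assumes "m \<in> simple_reps" "n \<in> N" "b \<in> B"
  shows "m \<otimes> b \<otimes> n \<in> cell (m \<otimes> n) \<union> cell n"
proof -
  obtain i where "i \<in> I" "s i = m <# H" using assms simple_reps_iff by blast
  then have "m <# B #> n \<subseteq> cell (m \<otimes> n) \<union> cell n"
    unfolding cell_def using exchange assms by simp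
  moreover have "m \<otimes> b \<otimes> n \<in> m <# B #> n"
    using assms by (auto simp: l_coset_def r_coset_def)
  ultimately show ?thesis by blast
qed

section \<open>Double cosets of \<open>B\<close> as equivalence classes\<close>

lemma mem_cell: "x \<in> cell n \<longleftrightarrow> (\<exists>a\<in>B. \<exists>b\<in>B. x = a \<otimes> n \<otimes> b)"
  unfolding cell_def r_coset_def set_mult_def by auto

lemma cellI: "a \<in> B \<Longrightarrow> b \<in> B \<Longrightarrow> a \<otimes> n \<otimes> b \<in> cell n"
  using mem_cell by blast

lemma cell_refl: "n \<in> carrier G \<Longrightarrow> n \<in> cell n"
  using cellI[of \<one> \<one> n] by simp

lemma cell_carrier: "n \<in> carrier G \<Longrightarrow> x \<in> cell n \<Longrightarrow> x \<in> carrier G"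
  by (auto simp: mem_cell)

lemma cell_mult:
  assumes "n \<in> carrier G" "a \<in> B" "x \<in> cell n" "b \<in> B"
  shows "a \<otimes> x \<otimes> b \<in> cell n"
proof -
  obtain c d where "c \<in> B" "d \<in> B" "x = c \<otimes> n \<otimes> d" using assms mem_cell by blast
  then have "a \<otimes> x \<otimes> b = (a \<otimes> c) \<otimes> n \<otimes> (d \<otimes> b)" using assms by (simp add: m_assoc)
  then show ?thesis using assms \<open>c \<in> B\<close> \<open>d \<in> B\<close> by (metis cellI B_closed(1))
qed

lemma cell_mult_left: "n \<in> carrier G \<Longrightarrow> a \<in> B \<Longrightarrow> x \<in> cell n \<Longrightarrow> a \<otimes> x \<in> cell n"
  using cell_mult[of n a x \<one>] cell_carrier[of n x] by simp

lemma cell_mult_right: "n \<in> carrier G \<Longrightarrow> x \<in> cell n \<Longrightarrow> b \<in> B \<Longrightarrow> x \<otimes> b \<in> cell n"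
  using cell_mult[of n \<one> x b] cell_carrier[of n x] by simp

lemma cell_sym:
  assumes "n \<in> carrier G" "x \<in> cell n"
  shows "n \<in> cell x"
proof -
  obtain a b where ab: "a \<in> B" "b \<in> B" "x = a \<otimes> n \<otimes> b" using assms mem_cell by blast
  then have "n = inv a \<otimes> x \<otimes> inv b" using assms by (simp add: m_assoc)
  then show ?thesis using cellI[of "inv a" "inv b" x] ab by simp
qed

lemma cell_trans:
  assumes "n \<in> carrier G" "x \<in> cell n" "y \<in> cell x"
  shows "y \<in> cell n"
  using assms cell_mult[of n _ x] by (auto simp: mem_cell[of y x])

lemma cell_inv:
  assumes "n \<in> carrier G" "x \<in> cell n"
  shows "inv x \<in> cell (inv n)"
proof -
  obtain a b where ab: "a \<in> B" "b \<in> B" "x = a \<otimes> n \<otimes> b" using assms mem_cell by blast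
  then have "inv x = inv b \<otimes> inv n \<otimes> inv a" using assms by (simp add: inv_mult_group m_assoc)
  then show ?thesis using cellI ab by simp
qed

text \<open>The exchange axiom multiplies by a generator on the left only. Inversion sends
  \<open>cell n\<close> to \<open>cell (inv n)\<close> and produces the mirror image.\<close>

lemma simple_exchange_right:
  assumes "m \<in> simple_reps" "n \<in> N" "b \<in> B"
  shows "n \<otimes> b \<otimes> m \<in> cell (n \<otimes> m) \<union> cell n"
proof -
  have e: "inv (inv m \<otimes> inv b \<otimes> inv n) = n \<otimes> b \<otimes> m"
    using assms by (simp add: inv_mult_group m_assoc)
  have "inv m \<otimes> inv b \<otimes> inv n \<in> cell (inv m \<otimes> inv n) \<union> cell (inv n)"
    using simple_exchange assms by simp
  then show ?thesis
    using cell_inv[of "inv m \<otimes> inv n" "inv m \<otimes> inv b \<otimes> inv n"]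
      cell_inv[of "inv n" "inv m \<otimes> inv b \<otimes> inv n"] assms
    unfolding e by (auto simp: inv_mult_group)
qed

section \<open>Words and the length function\<close>

lemma word_N: "word k n \<Longrightarrow> n \<in> N"
  by (induction rule: word.induct) auto

lemma word_mult_H: "word k n \<Longrightarrow> h \<in> H \<Longrightarrow> word k (n \<otimes> h)"
proof (induction rule: word.induct)
  case (word_H g)
  then show ?case by (auto intro!: word.intros)
next
  case (word_step m k n)
  then show ?case using word.word_step[of m k "n \<otimes> h"] word_N by (simp add: m_assoc)
qed

text \<open>Words grow on the left by definition; growth on the right is what inverting a word
  requires. In the base case \<open>h m\<close> is itself a representative of a generator.\<close>

lemma word_mult_simple: "word k n \<Longrightarrow> m \<in> simple_reps \<Longrightarrow> word (Suc k) (n \<otimes> m)"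
proof (induction rule: word.induct)
  case (word_H h)
  then have "h \<otimes> m \<in> simple_reps" using H_mult_simple by blast
  from word.word_step[OF this word.word_H[of \<one>]] show ?case using word_H by simp
next
  case (word_step t k n)
  then show ?case using word.word_step[of t "Suc k" "n \<otimes> m"] word_N by (simp add: m_assoc)
qed

lemma word_inv: "word k n \<Longrightarrow> word k (inv n)"
proof (induction rule: word.induct)
  case (word_H h)
  then show ?case by (auto intro!: word.intros)
next
  case (word_step m k n)
  then show ?case using word_mult_simple[of k "inv n" "inv m"] word_N by (simp add: inv_mult_group)
qed

lemma foldr_W: "set is \<subseteq> I \<Longrightarrow> foldr (\<otimes>\<^bsub>W\<^esub>) (map s is) \<one>\<^bsub>W\<^esub> \<in> carrier W"
proof -
  interpret W: group W by (rule group_W)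
  show "set is \<subseteq> I \<Longrightarrow> foldr (\<otimes>\<^bsub>W\<^esub>) (map s is) \<one>\<^bsub>W\<^esub> \<in> carrier W"
    by (induction "is") (auto simp: s_closed)
qed

lemma word_foldr:
  "word k n \<Longrightarrow> \<exists>is. length is = k \<and> set is \<subseteq> I \<and> n \<in> foldr (\<otimes>\<^bsub>W\<^esub>) (map s is) \<one>\<^bsub>W\<^esub>"
proof (induction rule: word.induct)
  case (word_H h)
  then show ?case by (intro exI[of _ "[]"]) (simp add: one_W)
next
  case (word_step m k n)
  then obtain "is" i where "length is = k" "set is \<subseteq> I"
    "n \<in> foldr (\<otimes>\<^bsub>W\<^esub>) (map s is) \<one>\<^bsub>W\<^esub>" "i \<in> I" "m \<in> s i"
    by (auto simp: simple_reps_def)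
  then show ?case
    by (intro exI[of _ "i # is"]) (auto simp: mem_mult_W)
qed

lemma foldr_word:
  "set is \<subseteq> I \<Longrightarrow> n \<in> foldr (\<otimes>\<^bsub>W\<^esub>) (map s is) \<one>\<^bsub>W\<^esub> \<Longrightarrow> word (length is) n"
proof (induction "is" arbitrary: n)
  case Nil
  then show ?case by (auto simp: one_W intro: word.intros)
next
  case (Cons i "is")
  from Cons.prems obtain m v where mv: "m \<in> s i" "n = m \<otimes> v"
    "v \<in> foldr (\<otimes>\<^bsub>W\<^esub>) (map s is) \<one>\<^bsub>W\<^esub>"
    by (auto simp: mem_mult_W)
  then have "m \<in> simple_reps" using Cons.prems by (auto simp: simple_reps_def)
  then show ?case using mv Cons word.word_step by auto
qed

text \<open>A coset product contains \<open>n\<close> exactly when it equals \<open>n H\<close>, by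
  \<open>W_mem\<close>, so words for \<open>n\<close> and words for its coset are the same lists of
  indices.\<close>

lemma word_iff:
  assumes "n \<in> N"
  shows "word k n \<longleftrightarrow>
    (\<exists>is. length is = k \<and> set is \<subseteq> I \<and> n <# H = foldr (\<otimes>\<^bsub>W\<^esub>) (map s is) \<one>\<^bsub>W\<^esub>)"
  using word_foldr[of k n] foldr_word[of _ n] W_mem[OF foldr_W, of _ n] assms by metis

lemma word_length_eq: "n \<in> N \<Longrightarrow> word_length W I s (n <# H) = len n"
  unfolding word_length_def len_def by (simp only: word_iff)

lemma word_mult: "word k n \<Longrightarrow> word l n' \<Longrightarrow> word (k + l) (n \<otimes> n')"
proof (induction rule: word.induct)
  case (word_H h)
  then have "h \<otimes> n' = n' \<otimes> (inv n' \<otimes> h \<otimes> n')"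
    using word_N by (simp add: m_assoc)
  then show ?case using word_mult_H[OF word_H(2) H_conj'] word_H word_N by auto
next
  case (word_step m k n)
  then show ?case using word.word_step[of m "k + l" "n \<otimes> n'"] word_N by (simp add: m_assoc)
qed

lemma word_simple: "m \<in> simple_reps \<Longrightarrow> word (Suc 0) m"
  using word_step[of m 0 \<one>] word_H[of \<one>] by simp

text \<open>Generation allows inverses, whereas words do not; each \<open>s i\<close> is an
  involution and hence its own inverse.\<close>

lemma ex_word:
  assumes "n \<in> N"
  shows "\<exists>k. word k n"
proof -
  have "\<forall>x\<in>X. \<exists>k. word k x" if "X \<in> generate W (s ` I)" for X
    using that
  proof (induction rule: generate.induct)
    case one
    then show ?case using one_W word_H by auto
  next
    case (incl X)
    then have "X \<subseteq> simple_reps" by (auto simp: simple_reps_def)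
    then show ?case using word_simple by blast
  next
    case (inv X)
    interpret W: group W by (rule group_W)
    obtain i where i: "i \<in> I" "X = s i" using inv by blast
    then have "X \<otimes>\<^bsub>W\<^esub> X = \<one>\<^bsub>W\<^esub>" "X \<in> carrier W"
      using s_square s_closed by (auto simp: numeral_2_eq_2)
    then have "inv\<^bsub>W\<^esub> X = X" using W.inv_equality by blast
    moreover have "X \<subseteq> simple_reps" using i by (auto simp: simple_reps_def)
    ultimately show ?case using word_simple by auto
  next
    case (eng X Y)
    then show ?case by (metis mem_mult_W word_mult)
  qed
  moreover have "n <# H \<in> generate W (s ` I)" using s_generate l_coset_W assms by simp
  moreover have "n \<in> n <# H" using W_mem[OF l_coset_W] assms by blast
  ultimately show ?thesis by blast
qed

lemma word_len: "n \<in> N \<Longrightarrow> word (len n) n"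
  unfolding len_def using ex_word LeastI_ex by metis

lemma len_le: "word k n \<Longrightarrow> len n \<le> k"
  unfolding len_def by (rule Least_le)

lemma len_inv: "n \<in> N \<Longrightarrow> len (inv n) = len n"
  using len_le[OF word_inv[OF word_len[of n]]] len_le[OF word_inv[OF word_len[of "inv n"]]]
  by simp

lemma len_mult_H: "n \<in> N \<Longrightarrow> h \<in> H \<Longrightarrow> len (n \<otimes> h) = len n"
proof -
  assume a: "n \<in> N" "h \<in> H"
  then have "len (n \<otimes> h) \<le> len n" using len_le word_mult_H word_len by blast
  moreover have "word (len (n \<otimes> h)) (n \<otimes> h \<otimes> inv h)"
    using a by (intro word_mult_H word_len) auto
  then have "len n \<le> len (n \<otimes> h)" using a len_le by (simp add: m_assoc)
  ultimately show ?thesis by simp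
qed

lemma len_simple_mult: "m \<in> simple_reps \<Longrightarrow> n \<in> N \<Longrightarrow> len (m \<otimes> n) \<le> Suc (len n)"
  using len_le word_step word_len by blast

section \<open>Consequences of the non-stability axiom\<close>

text \<open>The axiom denies only the equality \<open>m B m = B\<close>. As \<open>m m\<close> lies
  in \<open>B\<close>, the inclusion of \<open>m B m\<close> in \<open>B\<close> would already force
  equality.\<close>

lemma simple_not_stable:
  assumes "m \<in> simple_reps"
  shows "\<exists>b\<in>B. m \<otimes> b \<otimes> m \<notin> B"
proof (rule ccontr)
  assume "\<not> ?thesis"
  then have sub: "m \<otimes> b \<otimes> m \<in> B" if "b \<in> B" for b using that by blast
  have mm: "m \<otimes> m \<in> B" using simple_square[OF assms] by blast
  have "b \<in> m <# B #> m" if b: "b \<in> B" for b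
  proof -
    \<comment> \<open>The middle factor is \<open>inv m b inv m\<close>, written through
      \<open>m m\<close> and \<open>m b m\<close> so that its membership in \<open>B\<close> is
      visible.\<close>
    have "b = m \<otimes> (inv (m \<otimes> m) \<otimes> (m \<otimes> b \<otimes> m) \<otimes> inv (m \<otimes> m)) \<otimes> m"
      using assms b by (simp add: m_assoc inv_mult_group)
    moreover have "inv (m \<otimes> m) \<otimes> (m \<otimes> b \<otimes> m) \<otimes> inv (m \<otimes> m) \<in> B"
      by (intro B_closed sub mm b)
    ultimately show ?thesis unfolding l_coset_def r_coset_def by blast
  qed
  moreover have "m <# B #> m \<subseteq> B" using sub by (auto simp: l_coset_def r_coset_def)
  ultimately have "m <# B #> m = B" by blast
  then show False using assms not_stable simple_reps_iff by blast
qed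

lemma simple_not_H:
  assumes "m \<in> simple_reps"
  shows "m \<notin> H"
  using simple_not_stable[OF assms] by auto

text \<open>Some \<open>m b m\<close> lies outside \<open>B\<close>, while \<open>cell (m m)\<close>
  is contained in \<open>B\<close> because \<open>m m\<close> lies in \<open>H\<close>. Only the
  other alternative of the exchange axiom remains.\<close>

lemma simple_cell_square:
  assumes "m \<in> simple_reps"
  shows "\<exists>b\<in>B. m \<otimes> b \<otimes> m \<in> cell m"
proof -
  obtain b where b: "b \<in> B" "m \<otimes> b \<otimes> m \<notin> B" using simple_not_stable[OF assms] by blast
  have "cell (m \<otimes> m) \<subseteq> B" using simple_square[OF assms] by (auto simp: mem_cell)
  then show ?thesis using simple_exchange[of m m b] assms b by auto
qed

section \<open>Disjointness of the double cosets of distinct elements of \<open>W\<close>\<close>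

text \<open>Induction on the word for \<open>n\<close>. Cancelling its first letter \<open>m\<close>
  from \<open>n = m v\<close> puts \<open>v\<close> into \<open>cell (inv m n')\<close> or
  \<open>cell n'\<close>. The first case goes through by induction; in the second, \<open>n'\<close>
  would be as short as \<open>v\<close>, against the length bound.\<close>

lemma cell_eq_aux:
  "word k n \<Longrightarrow> n' \<in> N \<Longrightarrow> n \<in> cell n' \<Longrightarrow> k \<le> len n' \<Longrightarrow> \<exists>h\<in>H. n' = n \<otimes> h"
proof (induction arbitrary: n' rule: word.induct)
  case (word_H h)
  then have "n' \<in> cell h" using cell_sym[of n' h] by simp
  then have "n' \<in> B" using word_H by (auto simp: mem_cell)
  then show ?case using word_H
    by (intro bexI[of _ "inv h \<otimes> n'"]) (auto simp: m_assoc)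
next
  case (word_step m k v)
  note v = word_N[OF word_step.hyps(2)]
  obtain a b where ab: "a \<in> B" "b \<in> B" "m \<otimes> v = a \<otimes> n' \<otimes> b"
    using word_step.prems mem_cell by blast
  have "v = inv m \<otimes> (a \<otimes> n' \<otimes> b)"
    unfolding ab(3)[symmetric] using word_step.hyps(1) v by simp
  also have "\<dots> = inv m \<otimes> a \<otimes> n' \<otimes> b"
    using ab(1,2) word_step.hyps(1) word_step.prems(1) by (simp add: m_assoc)
  finally have v_eq: "v = inv m \<otimes> a \<otimes> n' \<otimes> b" .
  have "inv m \<otimes> a \<otimes> n' \<in> cell (inv m \<otimes> n') \<union> cell n'"
    using simple_exchange word_step ab by simp
  then consider "v \<in> cell (inv m \<otimes> n')" | "v \<in> cell n'"
    using v_eq cell_mult_right[of "inv m \<otimes> n'" "inv m \<otimes> a \<otimes> n'" b]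
      cell_mult_right[of n' "inv m \<otimes> a \<otimes> n'" b] ab(2) word_step.prems(1) word_step.hyps(1)
    by (metis N_carrier N_closed(1) UnE simple_N simple_inv)
  then show ?case
  proof cases
    case 1
    \<comment> \<open>A generator changes the length by at most one, so the bound
      \<open>Suc k\<close> on \<open>n'\<close> leaves the bound \<open>k\<close> that the induction
      hypothesis asks for.\<close>
    have "len (m \<otimes> (inv m \<otimes> n')) \<le> Suc (len (inv m \<otimes> n'))"
      using word_step by (intro len_simple_mult) auto
    then have "k \<le> len (inv m \<otimes> n')"
      using word_step.hyps(1) word_step.prems by simp
    then obtain h where h: "h \<in> H" "inv m \<otimes> n' = v \<otimes> h"
      using word_step.IH[of "inv m \<otimes> n'"] word_step.hyps(1) word_step.prems(1) 1 by auto
    have "n' = m \<otimes> (inv m \<otimes> n')" using word_step.hyps(1) word_step.prems(1) by simp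
    also have "\<dots> = m \<otimes> v \<otimes> h"
      unfolding h(2) using h(1) v word_step.hyps(1) by (simp add: m_assoc)
    finally have "n' = m \<otimes> v \<otimes> h" .
    with h show ?thesis by blast
  next
    case 2
    then obtain h where "h \<in> H" "n' = v \<otimes> h" using word_step.IH[of n'] word_step.prems by auto
    then have "len n' \<le> k" using len_le word_mult_H word_step.hyps(2) by blast
    then show ?thesis using word_step.prems(3) by simp
  qed
qed

lemma cell_eq:
  assumes "n \<in> N" "n' \<in> N" "n \<in> cell n'"
  shows "\<exists>h\<in>H. n' = n \<otimes> h"
proof (cases "len n \<le> len n'")
  case True
  then show ?thesis using cell_eq_aux word_len assms by blast
next
  case False
  then obtain h where h: "h \<in> H" "n = n' \<otimes> h"
    using cell_eq_aux[OF word_len[of n'], of n] assms cell_sym[of n' n] by auto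
  then have "n' = n \<otimes> inv h" using assms by (simp add: m_assoc)
  then show ?thesis using h by auto
qed

lemma cell_disjoint:
  assumes "n \<in> N" "n' \<in> N" "x \<in> cell n" "x \<in> cell n'"
  shows "\<exists>h\<in>H. n' = n \<otimes> h"
proof -
  have "n \<in> cell x" using assms cell_sym[of n x] by simp
  then have "n \<in> cell n'" using cell_trans[of n' x n] assms by simp
  then show ?thesis using cell_eq assms by blast
qed

section \<open>Products of double cosets: length-increasing factors and the longest element\<close>

text \<open>Of the two alternatives of the exchange axiom, \<open>cell n\<close> must be excluded.
  The induction runs over a reduced word \<open>n = t v\<close>: if \<open>t v b m\<close> were in
  \<open>cell (t v)\<close>, cancelling \<open>t\<close> would put \<open>v b m\<close> into
  \<open>cell v\<close> or \<open>cell (t v)\<close>, whereas induction places it in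
  \<open>cell (v m)\<close>; disjointness refutes both.\<close>

lemma cell_mult_simple:
  "word k n \<Longrightarrow> len n = k \<Longrightarrow> m \<in> simple_reps \<Longrightarrow> len n < len (n \<otimes> m) \<Longrightarrow> b \<in> B
    \<Longrightarrow> n \<otimes> b \<otimes> m \<in> cell (n \<otimes> m)"
proof (induction rule: word.induct)
  case (word_H h)
  then have "h \<otimes> b \<otimes> m = (h \<otimes> b \<otimes> inv h) \<otimes> (h \<otimes> m) \<otimes> \<one>" by (simp add: m_assoc)
  then show ?case using word_H cellI[of "h \<otimes> b \<otimes> inv h" \<one> "h \<otimes> m"] by simp
next
  case (word_step t k v)
  note v = word_N[OF word_step.hyps(2)]
  have tvN: "t \<otimes> v \<in> N" "v \<otimes> m \<in> N" using v word_step by auto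
  have tvm: "t \<otimes> v \<otimes> m = t \<otimes> (v \<otimes> m)" using v word_step by (simp add: m_assoc)
  have "len (t \<otimes> v) \<le> Suc (len v)" using len_simple_mult v word_step by blast
  \<comment> \<open>A tail of a reduced word is reduced.\<close>
  then have k: "len v = k" using len_le word_step by force
  have "len (t \<otimes> v \<otimes> m) \<le> Suc (len (v \<otimes> m))"
    unfolding tvm using len_simple_mult word_step tvN by blast
  then have "len v < len (v \<otimes> m)" using k word_step by simp
  then have IH: "v \<otimes> b \<otimes> m \<in> cell (v \<otimes> m)" using word_step k by blast
  show ?case
  proof (rule ccontr)
    assume "\<not> ?case"
    then have "t \<otimes> v \<otimes> b \<otimes> m \<in> cell (t \<otimes> v)"
      using simple_exchange_right[OF word_step.prems(2) tvN(1)] word_step.prems by blast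
    then obtain c d where cd: "c \<in> B" "d \<in> B" "t \<otimes> v \<otimes> b \<otimes> m = c \<otimes> (t \<otimes> v) \<otimes> d"
      using mem_cell by blast
    have "v \<otimes> b \<otimes> m = inv t \<otimes> (t \<otimes> v \<otimes> b \<otimes> m)"
      using v word_step.hyps(1) word_step.prems(2,4) by (simp add: m_assoc)
    also have "\<dots> = inv t \<otimes> c \<otimes> (t \<otimes> v) \<otimes> d"
      unfolding cd(3) using cd(1,2) v word_step.hyps(1) by (simp add: m_assoc)
    finally have eq: "v \<otimes> b \<otimes> m = inv t \<otimes> c \<otimes> (t \<otimes> v) \<otimes> d" .
    have "inv t \<otimes> (t \<otimes> v) = v" using v word_step.hyps(1) by simp
    then have "inv t \<otimes> c \<otimes> (t \<otimes> v) \<in> cell v \<union> cell (t \<otimes> v)"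
      using simple_exchange[OF simple_inv[OF word_step.hyps(1)] tvN(1) cd(1)] by simp
    then consider "v \<otimes> b \<otimes> m \<in> cell v" | "v \<otimes> b \<otimes> m \<in> cell (t \<otimes> v)"
      unfolding eq using cell_mult_right cd tvN v by auto
    then show False
    proof cases
      \<comment> \<open>Here \<open>v m\<close> and \<open>v\<close> represent the same element of
        \<open>W\<close>, which would put \<open>m\<close> into \<open>H\<close>.\<close>
      case 1
      then obtain h where "h \<in> H" "v \<otimes> m = v \<otimes> h" using cell_disjoint[OF v tvN(2) 1 IH] by blast
      then have "m = h" using v word_step by simp
      then show False using simple_not_H \<open>h \<in> H\<close> word_step by blast
    next
      \<comment> \<open>Here \<open>v m\<close> and \<open>t v\<close> represent the same element,
        so \<open>t v m\<close> would reduce to \<open>t t v\<close> up to \<open>H\<close> and have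
        a word of length \<open>k\<close>, shorter than \<open>t v\<close>.\<close>
      case 2
      then obtain h where h: "h \<in> H" "v \<otimes> m = t \<otimes> v \<otimes> h"
        using cell_disjoint[OF tvN(1) tvN(2) 2 IH] by blast
      have "word (0 + k) (t \<otimes> t \<otimes> v)"
        using word_step.hyps simple_square by (intro word_mult word.word_H)
      then have "word k (t \<otimes> t \<otimes> v \<otimes> h)" using word_mult_H h by simp
      moreover have "t \<otimes> v \<otimes> m = t \<otimes> t \<otimes> v \<otimes> h"
        unfolding tvm h(2) using v h(1) word_step.hyps(1) by (simp add: m_assoc)
      ultimately have "len (t \<otimes> v \<otimes> m) \<le> k" using len_le by simp
      then show False using word_step by simp
    qed
  qed
qed

text \<open>Inversion preserves length and swaps the sides, so this is the mirror image of
  \<open>cell_mult_simple\<close>.\<close>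

lemma simple_mult_cell:
  assumes "m \<in> simple_reps" "n \<in> N" "len n < len (m \<otimes> n)" "b \<in> B"
  shows "m \<otimes> b \<otimes> n \<in> cell (m \<otimes> n)"
proof -
  have e: "inv n \<otimes> inv m = inv (m \<otimes> n)" "inv (inv n \<otimes> inv b \<otimes> inv m) = m \<otimes> b \<otimes> n"
    using assms by (simp_all add: inv_mult_group m_assoc)
  have "inv n \<otimes> inv b \<otimes> inv m \<in> cell (inv n \<otimes> inv m)"
    using assms e(1) by (intro cell_mult_simple[OF word_len]) (simp_all add: len_inv)
  then have "inv (inv n \<otimes> inv b \<otimes> inv m) \<in> cell (inv (inv n \<otimes> inv m))"
    using assms by (intro cell_inv) simp_all
  then show ?thesis unfolding e using assms by simp
qed

text \<open>Otherwise \<open>C n0 C m = C (n0 m)\<close>. As \<open>n0 m\<close> is shorter than \<open>n0\<close>, also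
  \<open>C (n0 m) C m = C n0\<close>, whereas \<open>C m \<subseteq> C m C m\<close> makes \<open>C n0 C m C m\<close> meet \<open>C (n0 m)\<close>.\<close>

lemma cell_longest_simple:
  assumes n0: "n0 \<in> N" "is_longest W I s (n0 <# H)" and m: "m \<in> simple_reps"
  shows "\<exists>b\<in>B. n0 \<otimes> b \<otimes> m \<in> cell n0"
proof (rule ccontr)
  assume neg: "\<not> ?thesis"
  have nm: "n0 \<otimes> m \<in> N" using assms by simp
  have notH: "n0 \<otimes> m \<noteq> n0 \<otimes> h" "n0 \<noteq> n0 \<otimes> m \<otimes> h" if "h \<in> H" for h
  proof -
    show "n0 \<otimes> m \<noteq> n0 \<otimes> h" using that simple_not_H[OF m] n0 m by auto
    show "n0 \<noteq> n0 \<otimes> m \<otimes> h"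
    proof
      assume "n0 = n0 \<otimes> m \<otimes> h"
      then have "n0 = n0 \<otimes> (m \<otimes> h)" using that n0 m by (simp add: m_assoc)
      then have "m \<otimes> h = \<one>" using that n0 m l_cancel_one'[of n0 "m \<otimes> h"] by simp
      then have "m = inv h" using that m inv_equality[of m h] by simp
      then show False using that simple_not_H[OF m] by simp
    qed
  qed
  \<comment> \<open>Maximality compares \<open>n0\<close> only with other elements of
    \<open>W\<close>, so the cosets must be separated first.\<close>
  have "(n0 \<otimes> m) <# H \<noteq> n0 <# H"
  proof
    assume "(n0 \<otimes> m) <# H = n0 <# H"
    then have "n0 \<otimes> m \<in> n0 <# H" using W_mem[OF l_coset_W[OF nm], of "n0 \<otimes> m"] nm by simp
    then show False using notH l_coset_mem_iff n0 by blast
  qed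
  then have "len (n0 \<otimes> m) < len n0"
    using n0 nm l_coset_W word_length_eq unfolding is_longest_def by metis
  moreover have mm: "n0 \<otimes> m \<otimes> m = n0 \<otimes> (m \<otimes> m)" using n0 m by (simp add: m_assoc)
  ultimately have "len (n0 \<otimes> m) < len (n0 \<otimes> m \<otimes> m)"
    using len_mult_H simple_square m n0 by simp
  then have red: "n0 \<otimes> m \<otimes> b \<otimes> m \<in> cell (n0 \<otimes> m \<otimes> m)" if "b \<in> B" for b
    using cell_mult_simple[OF word_len[OF nm]] m that by blast
  obtain b where b: "b \<in> B" "m \<otimes> b \<otimes> m \<in> cell m" using simple_cell_square[OF m] by blast
  then obtain c d where cd: "c \<in> B" "d \<in> B" "m \<otimes> b \<otimes> m = c \<otimes> m \<otimes> d" using mem_cell by blast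
  \<comment> \<open>One element is located twice: bracketed as \<open>n0 (m b m)\<close> it lies in
    \<open>cell (n0 m)\<close>, bracketed as \<open>(n0 m) b m\<close> it lies in
    \<open>cell (n0 m m)\<close> by \<open>red\<close>.\<close>
  have "n0 \<otimes> c \<otimes> m \<in> cell (n0 \<otimes> m)"
    using neg simple_exchange_right m n0 cd by blast
  then have "n0 \<otimes> c \<otimes> m \<otimes> d \<in> cell (n0 \<otimes> m)" using cell_mult_right cd nm by simp
  moreover have "n0 \<otimes> c \<otimes> m \<otimes> d = n0 \<otimes> (c \<otimes> m \<otimes> d)" using n0 m cd by (simp add: m_assoc)
  moreover have "\<dots> = n0 \<otimes> m \<otimes> b \<otimes> m" using n0 m b by (simp add: cd(3)[symmetric] m_assoc)
  ultimately have "n0 \<otimes> m \<otimes> b \<otimes> m \<in> cell (n0 \<otimes> m)" by simp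
  moreover have "n0 \<otimes> m \<otimes> m \<in> N" using nm m by simp
  ultimately obtain h where h: "h \<in> H" "n0 \<otimes> m \<otimes> m = n0 \<otimes> m \<otimes> h"
    using cell_disjoint[OF nm] red[OF b(1)] by blast
  then have "m = h" using nm m by simp
  then show False using h simple_not_H m by blast
qed

text \<open>Induction along a reduced word \<open>t v\<close>: \<open>C n0\<close> is contained in
  \<open>C n0 C t\<close> and in \<open>C n0 C v\<close>, and \<open>C t C v = C (t v)\<close> as
  the length increases.\<close>

lemma cell_longest_mult:
  assumes n0: "n0 \<in> N" "is_longest W I s (n0 <# H)"
  shows "word k z \<Longrightarrow> len z = k \<Longrightarrow> \<exists>b\<in>B. n0 \<otimes> b \<otimes> z \<in> cell n0"
proof (induction rule: word.induct)
  case (word_H h)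
  then show ?case using n0 by (intro bexI[of _ \<one>] cell_mult_right cell_refl) auto
next
  case (word_step t k v)
  note v = word_N[OF word_step.hyps(2)]
  have t: "t \<in> N" using word_step by simp
  have "len (t \<otimes> v) \<le> Suc (len v)" using len_simple_mult v word_step by blast
  then have k: "len v = k" using len_le word_step by force
  then obtain b where b: "b \<in> B" "n0 \<otimes> b \<otimes> v \<in> cell n0" using word_step by blast
  obtain a where a: "a \<in> B" "n0 \<otimes> a \<otimes> t \<in> cell n0"
    using cell_longest_simple[OF n0] word_step by blast
  then obtain c d where cd: "c \<in> B" "d \<in> B" "n0 \<otimes> a \<otimes> t = c \<otimes> n0 \<otimes> d" using mem_cell by blast
  \<comment> \<open>The factor \<open>inv d b\<close> is chosen to cancel the \<open>d\<close> in
    \<open>n0 a t = c n0 d\<close>, which leaves \<open>c n0 b v\<close>, an element of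
    \<open>cell n0\<close>.\<close>
  have "t \<otimes> (inv d \<otimes> b) \<otimes> v \<in> cell (t \<otimes> v)"
    using simple_mult_cell v word_step k b cd by simp
  then obtain e f where ef: "e \<in> B" "f \<in> B" "t \<otimes> (inv d \<otimes> b) \<otimes> v = e \<otimes> (t \<otimes> v) \<otimes> f"
    using mem_cell by blast
  have "n0 \<otimes> (a \<otimes> e) \<otimes> (t \<otimes> v) \<otimes> f = n0 \<otimes> a \<otimes> (e \<otimes> (t \<otimes> v) \<otimes> f)"
    using n0 a ef t v by (simp add: m_assoc)
  also have "\<dots> = n0 \<otimes> a \<otimes> t \<otimes> (inv d \<otimes> b) \<otimes> v"
    unfolding ef(3)[symmetric] using n0 a b cd(1,2) t v by (simp add: m_assoc)
  also have "\<dots> = c \<otimes> (n0 \<otimes> b \<otimes> v)"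
    unfolding cd(3) using n0 a b cd(1,2) v by (simp add: m_assoc)
  also have "\<dots> \<in> cell n0" using cell_mult_left n0 b cd by simp
  finally have "n0 \<otimes> (a \<otimes> e) \<otimes> (t \<otimes> v) \<otimes> f \<otimes> inv f \<in> cell n0"
    using cell_mult_right n0 ef by simp
  moreover have "n0 \<otimes> (a \<otimes> e) \<otimes> (t \<otimes> v) \<otimes> f \<otimes> inv f = n0 \<otimes> (a \<otimes> e) \<otimes> (t \<otimes> v)"
    using n0 a ef t v by (simp add: m_assoc)
  ultimately show ?case using a ef by (intro bexI[of _ "a \<otimes> e"]) auto
qed

section \<open>The Bruhat decomposition and its form for the longest element\<close>

text \<open>The exchange axiom is applied to one letter of \<open>n\<close> at a time, from the
  right end of the word.\<close>

lemma mult_cells: "word k n \<Longrightarrow> n' \<in> N \<Longrightarrow> b \<in> B \<Longrightarrow> \<exists>z\<in>N. n \<otimes> b \<otimes> n' \<in> cell z"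
proof (induction rule: word.induct)
  case (word_H h)
  then show ?case using cell_mult_left[of n' "h \<otimes> b" n'] cell_refl[of n'] by auto
next
  case (word_step m k v)
  note v = word_N[OF word_step.hyps(2)]
  obtain z where z: "z \<in> N" "v \<otimes> b \<otimes> n' \<in> cell z" using word_step by blast
  then obtain c d where cd: "c \<in> B" "d \<in> B" "v \<otimes> b \<otimes> n' = c \<otimes> z \<otimes> d" using mem_cell by blast
  have "m \<otimes> v \<otimes> b \<otimes> n' = m \<otimes> (v \<otimes> b \<otimes> n')" using v word_step by (simp add: m_assoc)
  also have "\<dots> = m \<otimes> c \<otimes> z \<otimes> d"
    unfolding cd(3) using cd(1,2) z word_step by (simp add: m_assoc)
  finally have eq: "m \<otimes> v \<otimes> b \<otimes> n' = m \<otimes> c \<otimes> z \<otimes> d" .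
  have "m \<otimes> c \<otimes> z \<in> cell (m \<otimes> z) \<union> cell z" using simple_exchange word_step z cd by simp
  then show ?case
    unfolding eq using z cd cell_mult_right[of "m \<otimes> z"] cell_mult_right[of z] word_step.hyps
    by (metis N_carrier N_closed(1) Un_iff simple_N)
qed

text \<open>The union of the double cosets contains \<open>B\<close> and \<open>N\<close> and, by
  \<open>mult_cells\<close>, is closed under products.\<close>

theorem bruhat:
  assumes "g \<in> carrier G"
  shows "\<exists>n\<in>N. g \<in> cell n"
proof -
  have base: "\<exists>n\<in>N. x \<in> cell n" if "x \<in> B \<union> N" for x
    using that cell_refl[of x] cell_mult_right[of \<one> \<one> x] cell_refl[of \<one>]
    by (metis N_carrier N_closed(3) UnE B_carrier l_one one_closed)
  have "g \<in> generate G (B \<union> N)" using assms generated by simp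
  then show ?thesis
  proof (induction rule: generate.induct)
    case one
    then show ?case using base by simp
  next
    case (incl x)
    then show ?case using base by blast
  next
    case (inv x)
    then show ?case using base[of "inv x"] by auto
  next
    case (eng x y)
    then obtain n n' where n: "n \<in> N" "x \<in> cell n" "n' \<in> N" "y \<in> cell n'" by blast
    then obtain a b c d where ab: "a \<in> B" "b \<in> B" "x = a \<otimes> n \<otimes> b"
      and cd: "c \<in> B" "d \<in> B" "y = c \<otimes> n' \<otimes> d" using mem_cell by metis
    obtain z where z: "z \<in> N" "n \<otimes> (b \<otimes> c) \<otimes> n' \<in> cell z"
      using mult_cells[OF word_len] n ab cd by (metis B_closed(1))
    have "x \<otimes> y = a \<otimes> (n \<otimes> (b \<otimes> c) \<otimes> n') \<otimes> d" using ab cd n by (simp add: m_assoc)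
    then show ?case using z ab cd cell_mult by (metis N_carrier)
  qed
qed

text \<open>For \<open>g\<close> in \<open>cell z\<close>, the equation
  \<open>n0 b z = c n0 d\<close> from \<open>cell_longest_mult\<close> is solved for
  \<open>z\<close>.\<close>

theorem carrier_longest:
  assumes n0: "n0 \<in> N" "is_longest W I s (n0 <# H)" and g: "g \<in> carrier G"
  shows "\<exists>a\<in>B. \<exists>b\<in>B. \<exists>c\<in>B. g = a \<otimes> (inv n0 \<otimes> b \<otimes> n0) \<otimes> c"
proof -
  obtain z where z: "z \<in> N" "g \<in> cell z" using bruhat g by blast
  then obtain p q where pq: "p \<in> B" "q \<in> B" "g = p \<otimes> z \<otimes> q" using mem_cell by blast
  obtain b where b: "b \<in> B" "n0 \<otimes> b \<otimes> z \<in> cell n0"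
    using cell_longest_mult[OF n0 word_len] z by blast
  then obtain c d where cd: "c \<in> B" "d \<in> B" "n0 \<otimes> b \<otimes> z = c \<otimes> n0 \<otimes> d" using mem_cell by blast
  have "z = inv b \<otimes> inv n0 \<otimes> (n0 \<otimes> b \<otimes> z)"
    using z b(1) n0 by (simp add: m_assoc)
  then have "z = inv b \<otimes> inv n0 \<otimes> (c \<otimes> n0 \<otimes> d)" unfolding cd(3) .
  then have "g = (p \<otimes> inv b) \<otimes> (inv n0 \<otimes> c \<otimes> n0) \<otimes> (d \<otimes> q)"
    unfolding pq(3) using pq(1,2) b(1) cd(1,2) n0 by (simp add: m_assoc)
  then show ?thesis using pq b cd by (metis B_closed(1,2))
qed

end

section \<open>Passage from \<open>B\<close> to \<open>U\<close>\<close>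

theorem corollary2:
  fixes G (structure) and B N U :: "'a set" and I :: "'i set" and s :: "'i \<Rightarrow> 'a set"
  assumes "bn_pair G B N I s"
    and "finite (carrier (weyl_group G B N))"
    and "n0 \<in> N"
    and "is_longest (weyl_group G B N) I s (n0 <# (B \<inter> N))"
    and "subgroup U G" and "U \<subseteq> B"
    and "B = U <#> (B \<inter> N)"
  shows "carrier G = (B \<inter> N) <#> U <#> (inv n0 <# U #> n0) <#> U"
proof -
  interpret bn_pair G B N I s by fact
  have U [simp]: "u \<in> carrier G" "u \<in> B" if "u \<in> U" for u using that assms(6) by auto
  have UH: "\<exists>u\<in>U. \<exists>h\<in>H. b = u \<otimes> h" if "b \<in> B" for b
    using that assms(7) unfolding set_mult_def by blast
  \<comment> \<open>Taking inverses turns \<open>B = U H\<close> into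
    \<open>B = H U\<close>.\<close>
  have HU: "\<exists>h\<in>H. \<exists>u\<in>U. b = h \<otimes> u" if b: "b \<in> B" for b
  proof -
    obtain u h where uh: "u \<in> U" "h \<in> H" "inv b = u \<otimes> h" using UH b by (metis B_closed(2))
    then have "b = inv (u \<otimes> h)" using b by (metis inv_inv B_carrier)
    then have "b = inv h \<otimes> inv u" using uh by (simp add: inv_mult_group)
    then show ?thesis using uh subgroup.m_inv_closed[OF assms(5)]
      by (metis B_closed(2) Int_iff N_closed(2))
  qed
  have "g \<in> H <#> U <#> (inv n0 <# U #> n0) <#> U" if "g \<in> carrier G" for g
  proof -
    obtain a b c where abc: "a \<in> B" "b \<in> B" "c \<in> B" "g = a \<otimes> (inv n0 \<otimes> b \<otimes> n0) \<otimes> c"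
      using carrier_longest[OF assms(3,4) \<open>g \<in> carrier G\<close>] by metis
    \<comment> \<open>Factors in \<open>H\<close> travel leftwards: \<open>h\<close> is split off
      \<open>c\<close> and becomes \<open>k\<close> on passing \<open>n0\<close>; \<open>h'\<close>
      is split off \<open>b k\<close> and becomes \<open>l\<close> on passing \<open>inv n0\<close>;
      finally \<open>h''\<close> is split off \<open>a l\<close> and stays in front.\<close>
    obtain h u where c: "h \<in> H" "u \<in> U" "c = h \<otimes> u" using HU abc by blast
    define k where "k = n0 \<otimes> h \<otimes> inv n0"
    have k: "k \<in> H" unfolding k_def using H_conj c assms by blast
    obtain h' v where b: "h' \<in> H" "v \<in> U" "b \<otimes> k = h' \<otimes> v" using HU[of "b \<otimes> k"] abc k by auto
    define l where "l = inv n0 \<otimes> h' \<otimes> n0"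
    have l: "l \<in> H" unfolding l_def using H_conj' b assms by blast
    obtain h'' w where a: "h'' \<in> H" "w \<in> U" "a \<otimes> l = h'' \<otimes> w" using HU[of "a \<otimes> l"] abc l by auto
    have "n0 \<in> carrier G" using assms(3) by simp
    note cl = this abc(1-3) c(1,2) b(1,2) a(1,2) k l
    have kn: "k \<otimes> n0 = n0 \<otimes> h" unfolding k_def using cl by (simp add: m_assoc)
    have nl: "inv n0 \<otimes> h' = l \<otimes> inv n0" unfolding l_def using cl by (simp add: m_assoc)
    have "g = a \<otimes> inv n0 \<otimes> b \<otimes> (n0 \<otimes> h) \<otimes> u"
      unfolding abc(4) c(3) using cl by (simp add: m_assoc)
    also have "\<dots> = a \<otimes> inv n0 \<otimes> (b \<otimes> k) \<otimes> n0 \<otimes> u"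
      unfolding kn[symmetric] using cl by (simp add: m_assoc)
    also have "\<dots> = a \<otimes> (inv n0 \<otimes> h') \<otimes> v \<otimes> n0 \<otimes> u"
      unfolding b(3) using cl by (simp add: m_assoc)
    also have "\<dots> = (a \<otimes> l) \<otimes> inv n0 \<otimes> v \<otimes> n0 \<otimes> u"
      unfolding nl using cl by (simp add: m_assoc)
    also have "\<dots> = h'' \<otimes> w \<otimes> (inv n0 \<otimes> v \<otimes> n0) \<otimes> u"
      unfolding a(3) using cl by (simp add: m_assoc)
    finally have g: "g = h'' \<otimes> w \<otimes> (inv n0 \<otimes> v \<otimes> n0) \<otimes> u" .
    have prod: "x \<otimes> y \<in> X <#> Y" if "x \<in> X" "y \<in> Y" for x y X Y
      using that by (auto simp: set_mult_def)
    have "inv n0 \<otimes> v \<otimes> n0 \<in> inv n0 <# U #> n0"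
      using b(2) by (auto simp: l_coset_def r_coset_def)
    then show ?thesis
      unfolding g by (intro prod a(1,2) c(2))
  qed
  moreover have "H <#> U <#> (inv n0 <# U #> n0) <#> U \<subseteq> carrier G"
    using assms(3) by (auto simp: set_mult_def l_coset_def r_coset_def)
  ultimately show ?thesis by blast
qed

end
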